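(* If $G$ is a graph with chromatic number $\chi\geq 2$, then $$\|G\|_{F_\chi}\geq 2\mu_1(G).$$
   Context: Graphs are finite, simple and undirected. For a graph $G$ with adjacency matrix $A$, $\mu_1(G)$ is the largest eigenvalue of $A$, and $\|G\|_{F_k}=\sigma_1(A)+\cdots+\sigma_k(A)$ is the sum of the $k$ largest singular values of $A$ (with multiplicity), i.e. the sum of the $k$ largest absolute values of eigenvalues of $A$. *)

theory Defs
  imports
    "Graph_Theory.Digraph"
    "Jordan_Normal_Form.Spectral_Radius"
begin

text \<open>
  A finite simple undirected graph is a digraph satisfying the predicate \<open>graph\<close>: finite,
  loop-free, without parallel arcs, and with a symmetric arc relation, so that an undirected edge
  is a pair of opposite arcs.
\<close>

definition proper_colouring :: "('a, 'b) pre_digraph \<Rightarrow> nat \<Rightarrow> ('a \<Rightarrow> nat) \<Rightarrow> bool" where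
  "proper_colouring G k c \<longleftrightarrow>
     (\<forall>v \<in> verts G. c v < k) \<and>
     (\<forall>u \<in> verts G. \<forall>v \<in> verts G. u \<rightarrow>\<^bsub>G\<^esub> v \<longrightarrow> c u \<noteq> c v)"

definition chromatic_number :: "('a, 'b) pre_digraph \<Rightarrow> nat" where
  "chromatic_number G = (LEAST k. \<exists>c. proper_colouring G k c)"

text \<open>
  Matrices are indexed by \<open>{0..<n}\<close>, so the adjacency matrix is taken with respect to an ordering
  of the vertices, given as a list \<open>vs\<close> that contains every vertex exactly once.
\<close>

definition adjacency_matrix :: "('a, 'b) pre_digraph \<Rightarrow> 'a list \<Rightarrow> real mat" where
  "adjacency_matrix G vs =
     mat (length vs) (length vs) (\<lambda>(i, j). if vs ! i \<rightarrow>\<^bsub>G\<^esub> vs ! j then 1 else 0)"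

text \<open>
  Used for symmetric matrices of positive dimension only, for which the set of real eigenvalues is
  finite and nonempty.
\<close>

definition largest_eigenvalue :: "real mat \<Rightarrow> real" where
  "largest_eigenvalue A = Max (spectrum A)"

text \<open>
  The singular values are the square roots of the eigenvalues of \<open>A\<^sup>T A\<close> with multiplicity, in
  decreasing order. As \<open>A\<^sup>T A\<close> is symmetric positive semidefinite, its characteristic polynomial
  splits over the reals, so the multiset of its real roots, \<open>proots\<close>, has \<open>dim_col A\<close> elements.
\<close>

definition singular_values :: "real mat \<Rightarrow> real list" where
  "singular_values A =
     rev (sorted_list_of_multiset
       (image_mset sqrt (proots (char_poly (transpose_mat A * A)))))"

definition ky_fan_norm :: "nat \<Rightarrow> real mat \<Rightarrow> real" where
  "ky_fan_norm k A = sum_list (take k (singular_values A))"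

end

theory Submission imports Defs
begin

text \<open>
  Let \<open>v\<close> be a unit eigenvector for \<open>\<mu> = \<mu>\<^sub>1(G)\<close> and, for a colour \<open>j\<close>, let \<open>P\<^sub>j v\<close> be its restriction
  to the \<open>j\<close>-th colour class, \<open>w\<^sub>j\<close> the norm of \<open>P\<^sub>j v\<close> and \<open>x\<^sub>j = P\<^sub>j v / w\<^sub>j\<close> whenever \<open>w\<^sub>j \<noteq> 0\<close>. The
  \<open>x\<^sub>j\<close> are orthonormal, and so are their images \<open>y\<^sub>j = 2 w\<^sub>j v - x\<^sub>j\<close> under the reflection that fixes \<open>v\<close>.
  As colour classes are independent, \<open>\<langle>A x\<^sub>j, x\<^sub>j\<rangle> = 0\<close>, so that
  \<open>\<Sum>\<^sub>j \<langle>A x\<^sub>j, y\<^sub>j\<rangle> = 2 \<Sum>\<^sub>j w\<^sub>j \<langle>A x\<^sub>j, v\<rangle> = 2 \<mu> \<Sum>\<^sub>j w\<^sub>j\<^sup>2 = 2 \<mu>\<close>. By Ky Fan's maximum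
  principle the left-hand side is at most the sum of the \<open>\<chi>\<close> largest singular values of \<open>A\<close>.
\<close>

section \<open>Real eigenvalues and unit eigenvectors of symmetric matrices\<close>

text \<open>Over the complex numbers some eigenvalue exists. Moving the symmetric matrix across the
  bilinear product of an eigenvector with its conjugate shows that this eigenvalue equals its own
  conjugate, so it is a real root of the characteristic polynomial.\<close>

lemma symmetric_real_eigenvalue_exists:
  fixes A :: "real mat"
  assumes A: "A \<in> carrier_mat n n" and sym: "transpose_mat A = A" and n: "n > 0"
  shows "\<exists>e. eigenvalue A e"
proof -
  let ?C = "map_mat complex_of_real A"
  have C: "?C \<in> carrier_mat n n" using A by simp
  from spectrum_non_empty[OF C n] obtain \<mu> where mu: "eigenvalue ?C \<mu>"
    unfolding spectrum_def by auto
  then obtain z where z: "z \<in> carrier_vec n" "z \<noteq> 0\<^sub>v n" and ev: "?C *\<^sub>v z = \<mu> \<cdot>\<^sub>v z"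
    using C unfolding eigenvalue_def eigenvector_def by auto
  have Csym: "transpose_mat ?C = ?C" using sym by (metis map_mat_transpose)
  \<comment> \<open>The entries of \<open>A\<close> are real, so conjugation passes through
    \<open>?C\<close>.\<close>
  have conj_ev: "?C *\<^sub>v conjugate z = cnj \<mu> \<cdot>\<^sub>v conjugate z"
  proof -
    have "?C *\<^sub>v conjugate z = conjugate (?C *\<^sub>v z)"
      using A z(1) by (intro eq_vecI) (auto simp: scalar_prod_def row_def)
    then show ?thesis unfolding ev by (simp add: conjugate_smult_vec)
  qed
  have zc: "conjugate z \<in> carrier_vec n" using z by simp
  have "(?C *\<^sub>v z) \<bullet> conjugate z = z \<bullet> (?C *\<^sub>v conjugate z)"
    using transpose_vec_mult_scalar[OF C zc z(1)] Csym by simp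
  then have "\<mu> * (z \<bullet>c z) = cnj \<mu> * (z \<bullet>c z)"
    unfolding ev conj_ev using z(1) zc by simp
  moreover have "z \<bullet>c z \<noteq> 0" using z by simp
  ultimately have "\<mu> = cnj \<mu>" by simp
  then obtain r where r: "\<mu> = complex_of_real r"
    by (metis Reals_cases Reals_cnj_iff)
  have "poly (char_poly ?C) \<mu> = 0" using mu eigenvalue_root_char_poly[OF C] by simp
  then have "poly (map_poly complex_of_real (char_poly A)) (of_real r) = 0"
    using of_real_hom.char_poly_hom[OF A] r by metis
  then have "poly (char_poly A) r = 0"
    by (simp add: of_real_hom.poly_map_poly)
  then show ?thesis using eigenvalue_root_char_poly[OF A] by auto
qed

lemma scalar_prod_self_pos:
  fixes v :: "real vec"
  assumes "v \<in> carrier_vec n" "v \<noteq> 0\<^sub>v n"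
  shows "v \<bullet> v > 0"
  using conjugate_square_greater_0_vec[OF assms(1)] assms by (simp)

lemma unit_eigenvector_exists:
  fixes A :: "real mat"
  assumes A: "A \<in> carrier_mat n n" and e: "eigenvalue A e"
  shows "\<exists>v. v \<in> carrier_vec n \<and> v \<bullet> v = 1 \<and> A *\<^sub>v v = e \<cdot>\<^sub>v v"
proof -
  obtain u where u: "u \<in> carrier_vec n" "u \<noteq> 0\<^sub>v n" and ev: "A *\<^sub>v u = e \<cdot>\<^sub>v u"
    using e A unfolding eigenvalue_def eigenvector_def by auto
  define s where "s = 1 / sqrt (u \<bullet> u)"
  have pos: "u \<bullet> u > 0" using scalar_prod_self_pos[OF u] .
  have "s * s * (u \<bullet> u) = 1" using pos by (simp add: s_def field_simps)
  moreover have "A *\<^sub>v (s \<cdot>\<^sub>v u) = e \<cdot>\<^sub>v (s \<cdot>\<^sub>v u)"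
    using A u ev by (simp add: mult_mat_vec smult_smult_assoc mult.commute)
  ultimately show ?thesis using u by (intro exI[of _ "s \<cdot>\<^sub>v u"]) (auto simp: mult.assoc)
qed

section \<open>The spectral theorem by deflation with Householder matrices\<close>

text \<open>\<open>W\<close> is the identity minus \<open>c\<close> times the outer square of
  \<open>w\<close>, the difference of \<open>v\<close> and the first unit vector. It takes the place
  of completing \<open>v\<close> to an orthonormal basis and is its own inverse.\<close>

lemma householder_reflection:
  fixes v :: "real vec"
  assumes v: "v \<in> carrier_vec (Suc n)" and unit: "v \<bullet> v = 1"
  shows "\<exists>W \<in> carrier_mat (Suc n) (Suc n). transpose_mat W = W \<and> W * W = 1\<^sub>m (Suc n) \<and> col W 0 = v"
proof -
  define w where "w i = v $ i - (if i = 0 then 1 else 0)" for i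
  define S where "S = (\<Sum>i<Suc n. w i * w i)"
  \<comment> \<open>if \<open>v\<close> is the first unit vector, then \<open>S = 0\<close>, \<open>c = 2 / 0 = 0\<close> and \<open>W\<close> is the identity\<close>
  define c where "c = 2 / S"
  define W where "W = mat (Suc n) (Suc n) (\<lambda>(i,j). (if i = j then 1 else 0) - c * w i * w j)"
  have vv: "(\<Sum>i<Suc n. v $ i * v $ i) = 1"
    using unit v by (simp add: scalar_prod_def atLeast0LessThan)
  \<comment> \<open>The squared distance of two unit vectors is 2 minus twice their scalar product.
    For \<open>S \<noteq> 0\<close> this gives \<open>c * w 0 = - 1\<close>, which makes the first
    column of \<open>W\<close> equal to \<open>v\<close>.\<close>
  have S: "S = - 2 * w 0"
  proof -
    have "S = (\<Sum>i<Suc n. v $ i * v $ i - 2 * (if i = 0 then v $ i else 0) + (if i = 0 then 1 else 0))"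
      unfolding S_def w_def by (intro sum.cong) (auto simp: algebra_simps)
    also have "\<dots> = 1 - 2 * v $ 0 + 1"
      unfolding sum.distrib sum_subtractf vv sum_distrib_left[symmetric] by simp
    finally show ?thesis by (simp add: w_def)
  qed
  have w0: "w i = 0" if "S = 0" "i < Suc n" for i
    using that unfolding S_def by (subst (asm) sum_nonneg_eq_0_iff) auto
  have W: "W \<in> carrier_mat (Suc n) (Suc n)" by (simp add: W_def)
  \<comment> \<open>This cancels the correction terms in \<open>W * W\<close>. It also holds for
    \<open>S = 0\<close>, where \<open>c = 0\<close>.\<close>
  have cc: "c * c * S = 2 * c" by (simp add: c_def)
  have "W * W = 1\<^sub>m (Suc n)"
  proof (rule eq_matI)
    fix i j assume ij: "i < dim_row (1\<^sub>m (Suc n) :: real mat)" "j < dim_col (1\<^sub>m (Suc n) :: real mat)"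
    then have "(W * W) $$ (i,j) = (\<Sum>k<Suc n. ((if i = k then 1 else 0) - c * w i * w k) *
        ((if k = j then 1 else 0) - c * w k * w j))"
      by (simp add: W_def scalar_prod_def atLeast0LessThan del: sum.lessThan_Suc)
    also have "\<dots> = (\<Sum>k<Suc n. (if k = i then (if i = j then 1 else 0) else 0)
        - (if k = i then c * w i * w j else 0) - (if k = j then c * w i * w j else 0)
        + c * c * w i * w j * (w k * w k))"
      by (intro sum.cong) (auto simp: algebra_simps)
    also have "\<dots> = (if i = j then 1 else 0) - 2 * c * w i * w j + c * c * w i * w j * S"
      unfolding sum.distrib sum_subtractf S_def sum_distrib_left[symmetric]
      using ij by (simp del: sum.lessThan_Suc)
    also have "c * c * w i * w j * S = c * c * S * w i * w j" by simp
    finally show "(W * W) $$ (i,j) = 1\<^sub>m (Suc n) $$ (i,j)" using ij unfolding cc by simp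
  qed (auto simp: W_def)
  moreover have "transpose_mat W = W" unfolding W_def by (intro eq_matI) (auto simp: mult_ac)
  moreover have "col W 0 = v"
  proof (rule eq_vecI)
    fix i assume "i < dim_vec v"
    then have i: "i < Suc n" using v by simp
    have "c * w i * w 0 = - w i"
    proof (cases "S = 0")
      case False
      then have "c * w 0 = - 1" using S by (simp add: c_def field_simps)
      then show ?thesis by (metis mult.assoc mult.commute mult_minus1)
    qed (use w0 i in simp)
    then show "col W 0 $ i = v $ i" using i by (simp add: W_def w_def)
  qed (use v W in auto)
  ultimately show ?thesis using W by blast
qed

text \<open>Conjugation by a Householder matrix built from a unit eigenvector splits off its
  eigenvalue \<open>e\<close> as a block of size 1. The remaining block is symmetric, so the
  induction hypothesis diagonalises it.\<close>

theorem real_spectral_theorem: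
  fixes A :: "real mat"
  assumes "A \<in> carrier_mat n n" and "transpose_mat A = A"
  shows "\<exists>U l. U \<in> carrier_mat n n \<and> transpose_mat U * U = 1\<^sub>m n \<and> A = U * mat_diag n l * transpose_mat U"
  using assms
proof (induction n arbitrary: A)
  case 0
  then show ?case by (intro exI[of _ "1\<^sub>m 0"] exI) auto
next
  case (Suc n A)
  obtain e v where v: "v \<in> carrier_vec (Suc n)" "v \<bullet> v = 1" "A *\<^sub>v v = e \<cdot>\<^sub>v v"
    using symmetric_real_eigenvalue_exists[OF Suc.prems] unit_eigenvector_exists[OF Suc.prems(1)] by blast
  obtain W where W: "W \<in> carrier_mat (Suc n) (Suc n)" "transpose_mat W = W" "W * W = 1\<^sub>m (Suc n)" "col W 0 = v"
    using householder_reflection[OF v(1,2)] by auto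
  define B where "B = W * A * W"
  note A = Suc.prems(1)
  have B: "B \<in> carrier_mat (Suc n) (Suc n)" using W A by (simp add: B_def)
  have Bsym: "transpose_mat B = B"
    using W A Suc.prems(2) by (simp add: B_def transpose_mult[of _ "Suc n" "Suc n" _ "Suc n"]
        assoc_mult_mat[of _ "Suc n" "Suc n" _ "Suc n" _ "Suc n"])
  have "col (A * W) 0 = A *\<^sub>v v" using A W by (metis col_mult2 zero_less_Suc)
  \<comment> \<open>\<open>W\<close> sends the first unit vector to \<open>v\<close>. Being its own
    inverse, it sends \<open>v\<close> back, so the first column of \<open>B\<close> is
    \<open>e\<close> times that unit vector; symmetry then settles the first row.\<close>
  then have "col B 0 = W *\<^sub>v (e \<cdot>\<^sub>v col W 0)"
    using A W v by (simp add: B_def assoc_mult_mat[of _ "Suc n" "Suc n" _ "Suc n" _ "Suc n"] col_mult2[of _ "Suc n" "Suc n" _ "Suc n"] del: col_mult)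
  also have "\<dots> = e \<cdot>\<^sub>v col (W * W) 0"
    using W by (metis col_mult2 zero_less_Suc mult_mat_vec col_carrier_vec)
  finally have col0: "col B 0 = e \<cdot>\<^sub>v unit_vec (Suc n) 0" using W by simp
  have B_i0: "B $$ (i, 0) = (if i = 0 then e else 0)" if "i < Suc n" for i
  proof -
    have "B $$ (i, 0) = col B 0 $ i" using that B by simp
    then show ?thesis using that col0 by simp
  qed
  have B_0i: "B $$ (0, i) = (if i = 0 then e else 0)" if "i < Suc n" for i
  proof -
    have "B $$ (0, i) = transpose_mat B $$ (i, 0)" using that B by simp
    then show ?thesis using B_i0[OF that] Bsym by simp
  qed
  define B' where "B' = mat n n (\<lambda>(i,j). B $$ (Suc i, Suc j))"
  have B': "B' \<in> carrier_mat n n" by (simp add: B'_def)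
  have "B $$ (j, i) = B $$ (i, j)" if "i < Suc n" "j < Suc n" for i j
    using that Bsym B by (metis carrier_matD index_transpose_mat(1))
  then have "transpose_mat B' = B'" unfolding B'_def by (intro eq_matI) auto
  then obtain P l where P: "P \<in> carrier_mat n n" "transpose_mat P * P = 1\<^sub>m n"
    and B'P: "B' = P * mat_diag n l * transpose_mat P" using Suc.IH[OF B'] by auto
  let ?Z = "0\<^sub>m 1 n :: real mat" and ?Z' = "0\<^sub>m n 1 :: real mat"
  define V where "V = four_block_mat (1\<^sub>m 1) ?Z ?Z' P"
  define l' where "l' = case_nat e l"
  have V: "V \<in> carrier_mat (Suc n) (Suc n)" using P unfolding V_def
    by (metis four_block_carrier_mat one_carrier_mat plus_1_eq_Suc)
  have Vt: "transpose_mat V = four_block_mat (1\<^sub>m 1) ?Z ?Z' (transpose_mat P)"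
    using P unfolding V_def by (subst transpose_four_block_mat[of _ 1 1 _ n _ n]) auto
  have VtV: "transpose_mat V * V = 1\<^sub>m (Suc n)"
    using P unfolding Vt unfolding V_def
    by (subst mult_four_block_mat[of _ 1 1 _ n _ n _ _ 1 _ n]) auto
  have D: "mat_diag (Suc n) l' = four_block_mat (mat 1 1 (\<lambda>_. e)) ?Z ?Z' (mat_diag n l)"
    by (rule eq_matI) (auto simp: mat_diag_def l'_def split: nat.splits)
  have PD: "P * mat_diag n l \<in> carrier_mat n n" "P * mat_diag n l * transpose_mat P \<in> carrier_mat n n"
    using P by auto
  have "B = four_block_mat (mat 1 1 (\<lambda>_. e)) ?Z ?Z' B'"
    using B B_0i B_i0 by (intro eq_matI) (auto simp: B'_def)
  also have "\<dots> = V * mat_diag (Suc n) l' * transpose_mat V"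
    unfolding D Vt B'P unfolding V_def using P PD
    by (simp add: mult_four_block_mat[of _ 1 1 _ n _ n _ _ 1 _ n] left_mult_zero_mat[OF mat_diag_dim]
        right_mult_zero_mat[OF PD(1)] left_add_zero_mat[OF PD(2)])
  finally have BV: "B = V * mat_diag (Suc n) l' * transpose_mat V" .
  let ?U = "W * V"
  note assoc = assoc_mult_mat[of _ "Suc n" "Suc n" _ "Suc n" _ "Suc n"]
  have Ut: "transpose_mat ?U = transpose_mat V * W"
    using W V by (simp add: transpose_mult[of _ "Suc n" "Suc n" _ "Suc n"])
  have "W * (B * W) = W * W * A * (W * W)"
    using W(1) A by (simp add: B_def assoc)
  then have "A = W * (B * W)" using W A by simp
  then have "A = ?U * mat_diag (Suc n) l' * transpose_mat ?U"
    using W(1) V mat_diag_dim[of "Suc n" l'] unfolding BV Ut by (simp add: assoc del: mat_diag_dim)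
  moreover have "transpose_mat ?U * ?U = transpose_mat V * ((W * W) * V)"
    using W(1) V unfolding Ut by (simp add: assoc)
  then have "transpose_mat ?U * ?U = 1\<^sub>m (Suc n)" using W(3) V VtV by simp
  moreover have "?U \<in> carrier_mat (Suc n) (Suc n)" using W V by simp
  ultimately show ?case by blast
qed

section \<open>Bounds for weighted sums\<close>

text \<open>Bessel's inequality for the unit vector with index \<open>i\<close>: \<open>?s\<close>
  is its projection onto the span of the orthonormal vectors \<open>p j\<close>, and the squared
  distance to the projection is nonnegative.\<close>

lemma bessel_coordinate:
  fixes p :: "'j \<Rightarrow> nat \<Rightarrow> real"
  assumes J: "finite J" and i: "i < n"
    and orth: "\<And>j j'. j \<in> J \<Longrightarrow> j' \<in> J \<Longrightarrow> (\<Sum>m<n. p j m * p j' m) = (if j = j' then 1 else 0)"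
  shows "(\<Sum>j\<in>J. (p j i)\<^sup>2) \<le> 1"
proof -
  let ?s = "\<lambda>m. \<Sum>j\<in>J. p j i * p j m"
  have "(\<Sum>m<n. (?s m)\<^sup>2) = (\<Sum>m<n. \<Sum>j\<in>J. \<Sum>j'\<in>J. p j i * p j' i * (p j m * p j' m))"
    by (simp add: power2_eq_square sum_product mult_ac)
  also have "\<dots> = (\<Sum>j\<in>J. \<Sum>j'\<in>J. p j i * p j' i * (\<Sum>m<n. p j m * p j' m))"
    by (subst sum.swap, intro sum.cong refl, subst sum.swap) (simp add: sum_distrib_left)
  also have "\<dots> = (\<Sum>j\<in>J. (p j i)\<^sup>2)"
    using J by (simp add: orth power2_eq_square if_distrib sum.delta' cong: if_cong)
  finally have sq: "(\<Sum>m<n. (?s m)\<^sup>2) = (\<Sum>j\<in>J. (p j i)\<^sup>2)" .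
  have "0 \<le> (\<Sum>m<n. ((if m = i then 1 else 0) - ?s m)\<^sup>2)" by (intro sum_nonneg) auto
  also have "\<dots> = (\<Sum>m<n. (if m = i then 1 - 2 * ?s i else 0) + (?s m)\<^sup>2)"
    by (intro sum.cong) (auto simp: power2_eq_square algebra_simps)
  also have "\<dots> = 1 - 2 * ?s i + (\<Sum>j\<in>J. (p j i)\<^sup>2)"
    using i by (simp add: sum.distrib sq)
  finally show ?thesis by (simp add: power2_eq_square)
qed

text \<open>
  The bound is symmetric in the values \<open>l i\<close>. With \<open>t\<close> the \<open>k\<close>-th largest of them it is the sum of the
  \<open>k\<close> largest ones, so no rearrangement of the indices is needed.
\<close>
lemma weighted_sum_le_threshold:
  fixes l c :: "nat \<Rightarrow> real"
  assumes t: "t \<ge> 0" and c: "\<And>i. i < n \<Longrightarrow> 0 \<le> c i \<and> c i \<le> 1" and k: "(\<Sum>i<n. c i) \<le> k"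
  shows "(\<Sum>i<n. l i * c i) \<le> (\<Sum>i<n. max 0 (l i - t)) + t * k"
proof -
  \<comment> \<open>Split \<open>l i\<close> into \<open>l i - t\<close> and \<open>t\<close>. The
    first part is at most its positive part, whose weight is at most 1.\<close>
  have "l i * c i \<le> max 0 (l i - t) + t * c i" if "i < n" for i
  proof -
    have "(l i - t) * c i \<le> max 0 (l i - t) * c i" using c[OF that] by (intro mult_right_mono) auto
    also have "\<dots> \<le> max 0 (l i - t) * 1" using c[OF that] by (intro mult_left_mono) auto
    finally show ?thesis by (simp add: algebra_simps)
  qed
  then have "(\<Sum>i<n. l i * c i) \<le> (\<Sum>i<n. max 0 (l i - t) + t * c i)" by (intro sum_mono) auto
  also have "\<dots> \<le> (\<Sum>i<n. max 0 (l i - t)) + t * k"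
    using mult_left_mono[OF k t] by (simp add: sum.distrib sum_distrib_left)
  finally show ?thesis .
qed

text \<open>At the threshold \<open>t\<close>, the first \<open>k\<close> entries of
  \<open>s\<close> are at least \<open>t\<close> and the others at most \<open>t\<close>. The
  positive parts thus add up to the sum of the first \<open>k\<close> entries minus
  \<open>t * k\<close>, and the term \<open>t * k\<close> of the threshold bound cancels.\<close>

lemma weighted_sum_le_largest:
  fixes l c :: "nat \<Rightarrow> real" and s :: "real list"
  assumes s: "mset s = image_mset l (mset_set {..<n})" and desc: "sorted_wrt (\<ge>) s"
    and l: "\<And>i. i < n \<Longrightarrow> l i \<ge> 0"
    and c: "\<And>i. i < n \<Longrightarrow> 0 \<le> c i \<and> c i \<le> 1" and k: "(\<Sum>i<n. c i) \<le> real k"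
    and "k > 0"
  shows "(\<Sum>i<n. l i * c i) \<le> sum_list (take k s)"
proof -
  have len: "length s = n" using arg_cong[OF s, of size] by simp
  have nonneg: "x \<ge> 0" if "x \<in> set s" for x
    using that l arg_cong[OF s, of set_mset] by auto
  have sums: "(\<Sum>i<n. f (l i)) = (\<Sum>x\<leftarrow>s. f x)" for f :: "real \<Rightarrow> real"
    using arg_cong[OF s, of "\<lambda>M. sum_mset (image_mset f M)"]
    by (simp add: image_mset.compositionality o_def sum_unfold_sum_mset flip: sum_mset_sum_list)
  show ?thesis
  proof (cases "k \<le> n")
    case True
    \<comment> \<open>Positions start at 0, so this is the \<open>k\<close>-th largest value; the
      index is valid as \<open>0 < k\<close> and \<open>k \<le> n\<close>.\<close>
    define t where "t = s ! (k - 1)"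
    have t: "t \<ge> 0" using nonneg True \<open>k > 0\<close> len unfolding t_def by auto
    have big: "s ! i \<ge> t" if "i < k" for i
      using sorted_wrt_nth_less[OF desc, of i "k - 1"] that len True unfolding t_def
      by (cases "i = k - 1") auto
    have small: "s ! i \<le> t" if "k \<le> i" "i < n" for i
      using sorted_wrt_nth_less[OF desc, of "k - 1" i] that len \<open>k > 0\<close> unfolding t_def by auto
    have "(\<Sum>i<n. max 0 (l i - t)) = (\<Sum>i<n. max 0 (s ! i - t))"
      unfolding sums[of "\<lambda>x. max 0 (x - t)"] by (simp add: sum_list_sum_nth len atLeast0LessThan)
    also have "\<dots> = (\<Sum>i<k. max 0 (s ! i - t))"
      using True small by (intro sum.mono_neutral_right) (auto simp: max_absorb1)
    also have "\<dots> = (\<Sum>i<k. s ! i - t)" using big by (intro sum.cong) auto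
    also have "\<dots> = sum_list (take k s) - t * real k"
      using True len by (simp add: sum_subtractf sum_list_sum_nth atLeast0LessThan)
    finally show ?thesis using weighted_sum_le_threshold[OF t c k, of l] by simp
  next
    case False
    \<comment> \<open>Here \<open>take k s\<close> is all of \<open>s\<close>, so bounding each
      weight by 1 suffices.\<close>
    have "(\<Sum>i<n. l i * c i) \<le> (\<Sum>i<n. l i * 1)"
      using l c by (intro sum_mono mult_left_mono) auto
    then show ?thesis using False len sums[of "\<lambda>x. x"] by simp
  qed
qed

section \<open>Singular values and Ky Fan's maximum principle\<close>

text \<open>The Gram matrix is similar to the diagonal matrix \<open>E\<close> of the squares of the
  \<open>l i\<close>, so its characteristic polynomial is a product of linear factors. The square
  roots of its roots are absolute values.\<close>

lemma mset_singular_values: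
  fixes U :: "real mat"
  assumes U: "U \<in> carrier_mat n n" "transpose_mat U * U = 1\<^sub>m n"
  shows "mset (singular_values (U * mat_diag n l * transpose_mat U)) = image_mset (\<lambda>i. \<bar>l i\<bar>) (mset_set {..<n})"
proof -
  let ?D = "mat_diag n l" and ?A = "U * mat_diag n l * transpose_mat U"
  define E where "E = mat_diag n (\<lambda>i. l i * l i)"
  note assoc = assoc_mult_mat[of _ n n _ n _ n]
  have D: "?D \<in> carrier_mat n n" and E: "E \<in> carrier_mat n n" by (auto simp: E_def)
  have Dt: "transpose_mat ?D = ?D" by (rule eq_matI) (auto simp: mat_diag_def)
  have At: "transpose_mat ?A = ?A"
  proof -
    have "transpose_mat ?A = U * transpose_mat (U * ?D)"
      using U(1) D by (subst transpose_mult[of _ n n _ n]) auto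
    also have "transpose_mat (U * ?D) = ?D * transpose_mat U"
      using U(1) D Dt by (subst transpose_mult[of _ n n _ n]) auto
    finally show ?thesis using U(1) D by (simp add: assoc)
  qed
  have "?A * ?A = U * (?D * ((transpose_mat U * U) * (?D * transpose_mat U)))"
    using U(1) D by (simp add: assoc del: mat_diag_dim)
  also have "\<dots> = U * E * transpose_mat U"
  proof -
    have "?D * (?D * transpose_mat U) = E * transpose_mat U"
      using U(1) D by (simp add: E_def flip: assoc)
    then show ?thesis using U(1) D E unfolding U(2) by (simp add: assoc left_mult_one_mat[of _ n n] del: mat_diag_dim)
  qed
  finally have AA: "transpose_mat ?A * ?A = U * E * transpose_mat U" unfolding At .
  have UU: "U * transpose_mat U = 1\<^sub>m n"
    using U mat_mult_left_right_inverse[of "transpose_mat U" n U] by simp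
  have "similar_mat_wit (U * E * transpose_mat U) E U (transpose_mat U)"
    using U UU E by (intro similar_mat_witI[of _ _ n]) auto
  then have "similar_mat (transpose_mat ?A * ?A) E"
    unfolding AA similar_mat_def by blast
  then have "char_poly (transpose_mat ?A * ?A) = char_poly E" by (rule char_poly_similar)
  also have "\<dots> = (\<Prod>a \<leftarrow> diag_mat E. [:- a, 1:])"
    using E by (intro char_poly_upper_triangular) (auto simp: E_def mat_diag_def)
  also have "\<dots> = (\<Prod>i<n. [:- (l i * l i), 1:])"
    by (simp add: diag_mat_def E_def mat_diag_def o_def prod.list_conv_set_nth atLeast0LessThan)
  finally have cp: "char_poly (transpose_mat ?A * ?A) = (\<Prod>i<n. [:- (l i * l i), 1:])" .
  have "proots (\<Prod>i<n. [:- (l i * l i), 1:]) = image_mset (\<lambda>i. l i * l i) (mset_set {..<n})"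
    by (subst proots_prod) (auto simp: sum_unfold_sum_mset)
  then show ?thesis unfolding singular_values_def cp
    by (simp add: image_mset.compositionality o_def)
qed

lemma sorted_singular_values: "sorted_wrt (\<ge>) (singular_values A)"
  unfolding singular_values_def sorted_wrt_rev by simp

lemma mat_diag_mult_vec_index:
  fixes x :: "'a :: semiring_0 vec"
  assumes "x \<in> carrier_vec n" "i < n"
  shows "(mat_diag n l *\<^sub>v x) $ i = l i * x $ i"
  using assms by (simp add: mat_diag_def scalar_prod_def if_distrib[of "\<lambda>a. a * _"] cong: if_cong)

text \<open>Moving the left factor \<open>U\<close> to the other side of the scalar product as its
  transpose leaves a diagonal form.\<close>

lemma mult_mat_vec_spectral_scalar_prod:
  fixes U :: "real mat"
  assumes "U \<in> carrier_mat n n" "x \<in> carrier_vec n" "y \<in> carrier_vec n"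
  shows "((U * mat_diag n l * transpose_mat U) *\<^sub>v x) \<bullet> y =
    (\<Sum>i<n. l i * (transpose_mat U *\<^sub>v x) $ i * (transpose_mat U *\<^sub>v y) $ i)"
proof -
  let ?x = "transpose_mat U *\<^sub>v x" and ?y = "transpose_mat U *\<^sub>v y"
  have Dx: "mat_diag n l *\<^sub>v ?x \<in> carrier_vec n"
    by (metis mat_diag_dim mult_mat_vec_carrier assms transpose_carrier_mat)
  have xy: "?x \<in> carrier_vec n" "?y \<in> carrier_vec n" using assms by auto
  have "(U * mat_diag n l * transpose_mat U) *\<^sub>v x = U *\<^sub>v (mat_diag n l *\<^sub>v ?x)"
    using assms by (simp add: assoc_mult_mat_vec[of _ n n _ n])
  then have "((U * mat_diag n l * transpose_mat U) *\<^sub>v x) \<bullet> y = (mat_diag n l *\<^sub>v ?x) \<bullet> ?y"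
    using transpose_vec_mult_scalar[of "transpose_mat U" n n y "mat_diag n l *\<^sub>v ?x"] assms Dx by simp
  also have "(mat_diag n l *\<^sub>v ?x) \<bullet> ?y = (\<Sum>i<n. l i * ?x $ i * ?y $ i)"
    using carrier_vecD[OF xy(2)] mat_diag_mult_vec_index[OF xy(1), of _ l]
    unfolding scalar_prod_def[of _ ?y] by (intro sum.cong) auto
  finally show ?thesis .
qed

text \<open>In eigenvector coordinates, the inequality of arithmetic and geometric means bounds the
  left-hand side by a sum of the \<open>\<bar>l i\<bar>\<close> with weights \<open>c i\<close>.
  Bessel's inequality gives \<open>c i \<le> 1\<close>, and orthonormality makes the weights add up
  to \<open>card J\<close>. Allowing fewer than \<open>k\<close> pairs makes it possible to leave
  out colours later.\<close>

theorem ky_fan_maximum_principle: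
  fixes A :: "real mat" and x y :: "'j \<Rightarrow> real vec"
  assumes A: "A \<in> carrier_mat n n" "transpose_mat A = A"
    and J: "finite J" "card J \<le> k" and "k > 0"
    and x: "\<And>j. j \<in> J \<Longrightarrow> x j \<in> carrier_vec n" and y: "\<And>j. j \<in> J \<Longrightarrow> y j \<in> carrier_vec n"
    and orth_x: "\<And>i j. i \<in> J \<Longrightarrow> j \<in> J \<Longrightarrow> x i \<bullet> x j = (if i = j then 1 else 0)"
    and orth_y: "\<And>i j. i \<in> J \<Longrightarrow> j \<in> J \<Longrightarrow> y i \<bullet> y j = (if i = j then 1 else 0)"
  shows "(\<Sum>j\<in>J. (A *\<^sub>v x j) \<bullet> y j) \<le> ky_fan_norm k A"
proof -
  obtain U l where U: "U \<in> carrier_mat n n" "transpose_mat U * U = 1\<^sub>m n"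
    and AU: "A = U * mat_diag n l * transpose_mat U"
    using real_spectral_theorem[OF A] by blast
  define p where "p j i = (transpose_mat U *\<^sub>v x j) $ i" for j i
  define q where "q j i = (transpose_mat U *\<^sub>v y j) $ i" for j i
  have UU: "U * transpose_mat U = 1\<^sub>m n"
    using U mat_mult_left_right_inverse[of "transpose_mat U" n U] by simp
  \<comment> \<open>The diagonal form with all values equal to 1 is the scalar product itself, since
    \<open>U\<close> is orthogonal.\<close>
  have inner: "(\<Sum>m<n. (transpose_mat U *\<^sub>v a) $ m * (transpose_mat U *\<^sub>v b) $ m) = a \<bullet> b"
    if "a \<in> carrier_vec n" "b \<in> carrier_vec n" for a b
    using mult_mat_vec_spectral_scalar_prod[OF U(1) that, of "\<lambda>_. 1"] U(1) UU that by simp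
  have p_orth: "(\<Sum>m<n. p i m * p j m) = (if i = j then 1 else 0)" if "i \<in> J" "j \<in> J" for i j
    using that inner[OF x x] orth_x unfolding p_def by simp
  have q_orth: "(\<Sum>m<n. q i m * q j m) = (if i = j then 1 else 0)" if "i \<in> J" "j \<in> J" for i j
    using that inner[OF y y] orth_y unfolding q_def by simp
  define c where "c i = (\<Sum>j\<in>J. ((p j i)\<^sup>2 + (q j i)\<^sup>2) / 2)" for i
  have c_nonneg: "0 \<le> c i" for i unfolding c_def by (intro sum_nonneg) auto
  have c_le: "c i \<le> 1" if "i < n" for i
    using bessel_coordinate[OF J(1) that p_orth] bessel_coordinate[OF J(1) that q_orth]
    unfolding c_def by (simp add: sum.distrib flip: sum_divide_distrib)
  have "(\<Sum>i<n. c i) = (\<Sum>j\<in>J. ((\<Sum>i<n. p j i * p j i) + (\<Sum>i<n. q j i * q j i)) / 2)"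
    unfolding c_def by (subst sum.swap) (simp add: power2_eq_square sum.distrib flip: sum_divide_distrib)
  also have "\<dots> = real (card J)" by (simp add: p_orth q_orth)
  finally have c_sum: "(\<Sum>i<n. c i) \<le> real k" using J by simp
  have "(\<Sum>j\<in>J. (A *\<^sub>v x j) \<bullet> y j) = (\<Sum>j\<in>J. \<Sum>i<n. l i * p j i * q j i)"
    unfolding AU p_def q_def by (intro sum.cong refl mult_mat_vec_spectral_scalar_prod U x y)
  also have "\<dots> \<le> (\<Sum>j\<in>J. \<Sum>i<n. \<bar>l i\<bar> * (((p j i)\<^sup>2 + (q j i)\<^sup>2) / 2))"
  proof (intro sum_mono)
    fix j i
    have "\<bar>p j i * q j i\<bar> \<le> ((p j i)\<^sup>2 + (q j i)\<^sup>2) / 2"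
      using sum_squares_bound[of "\<bar>p j i\<bar>" "\<bar>q j i\<bar>"] by (simp add: abs_mult)
    then have "\<bar>l i\<bar> * \<bar>p j i * q j i\<bar> \<le> \<bar>l i\<bar> * (((p j i)\<^sup>2 + (q j i)\<^sup>2) / 2)"
      by (intro mult_left_mono) auto
    then show "l i * p j i * q j i \<le> \<bar>l i\<bar> * (((p j i)\<^sup>2 + (q j i)\<^sup>2) / 2)"
      using abs_ge_self[of "l i * (p j i * q j i)"] by (simp add: abs_mult mult.assoc)
  qed
  also have "\<dots> = (\<Sum>i<n. \<bar>l i\<bar> * c i)"
    unfolding c_def by (subst sum.swap) (simp add: sum_distrib_left)
  also have "\<dots> \<le> sum_list (take k (singular_values A))"
    using c_nonneg c_le c_sum \<open>k > 0\<close> mset_singular_values[OF U, of l] sorted_singular_values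
    by (intro weighted_sum_le_largest) (auto simp: AU)
  finally show ?thesis unfolding ky_fan_norm_def .
qed

section \<open>From colour classes to orthonormal systems\<close>

text \<open>The colouring enters through \<open>proper\<close>: the quadratic form of
  \<open>A\<close> vanishes on vectors supported on a single colour class.\<close>

lemma two_eigenvalue_le_ky_fan_norm:
  fixes A :: "real mat"
  assumes A: "A \<in> carrier_mat n n" "transpose_mat A = A" and e: "eigenvalue A e"
    and colours: "\<And>i. i < n \<Longrightarrow> c i < k"
    and proper: "\<And>i j. i < n \<Longrightarrow> j < n \<Longrightarrow> c i = c j \<Longrightarrow> A $$ (i,j) = 0"
    and "k > 0"
  shows "2 * e \<le> ky_fan_norm k A"
proof -
  obtain v where v: "v \<in> carrier_vec n" "v \<bullet> v = 1" "A *\<^sub>v v = e \<cdot>\<^sub>v v"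
    using unit_eigenvector_exists[OF A(1) e] by blast
  define w where "w j = sqrt (\<Sum>i<n. if c i = j then (v $ i)\<^sup>2 else 0)" for j
  \<comment> \<open>Colours on which \<open>v\<close> vanishes are dropped: there division by zero
    would make \<open>x j\<close> the zero vector instead of a unit vector.\<close>
  define J where "J = {j. j < k \<and> w j \<noteq> 0}"
  define x where "x j = vec n (\<lambda>i. if c i = j then v $ i / w j else 0)" for j
  define y where "y j = (2 * w j) \<cdot>\<^sub>v v - x j" for j
  have J: "finite J" "card J \<le> k"
    using card_mono[of "{..<k}" J] by (auto simp: J_def)
  have x: "x j \<in> carrier_vec n" for j by (simp add: x_def)
  have y: "y j \<in> carrier_vec n" for j using v x by (simp add: y_def)
  have w2: "w j * w j = (\<Sum>i<n. if c i = j then (v $ i)\<^sup>2 else 0)" for j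
    unfolding w_def by (intro real_sqrt_mult_self[THEN trans] abs_of_nonneg sum_nonneg) auto
  have w_nonzero: "w j \<noteq> 0" if "j \<in> J" for j using that by (simp add: J_def)
  have xv: "x j \<bullet> v = w j" if "j \<in> J" for j
  proof -
    have "x j \<bullet> v = (\<Sum>i<n. (if c i = j then (v $ i)\<^sup>2 else 0) / w j)"
      using v by (auto simp: scalar_prod_def x_def power2_eq_square atLeast0LessThan intro!: sum.cong)
    also have "\<dots> = w j * w j / w j" by (simp add: w2 flip: sum_divide_distrib)
    finally show ?thesis using w_nonzero[OF that] by simp
  qed
  have vx: "v \<bullet> x j = w j" if "j \<in> J" for j
    using xv[OF that] comm_scalar_prod[OF x v(1)] by simp
  have orth_x: "x i \<bullet> x j = (if i = j then 1 else 0)" if "i \<in> J" "j \<in> J" for i j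
  proof (cases "i = j")
    case True
    have "x j \<bullet> x j = (\<Sum>i<n. (if c i = j then (v $ i)\<^sup>2 else 0) / (w j * w j))"
      by (auto simp: scalar_prod_def x_def power2_eq_square atLeast0LessThan intro!: sum.cong)
    also have "\<dots> = w j * w j / (w j * w j)" by (simp add: w2 flip: sum_divide_distrib)
    finally show ?thesis using w_nonzero[OF that(2)] True by simp
  next
    case False
    then show ?thesis by (auto simp: scalar_prod_def x_def intro!: sum.neutral)
  qed
  have orth_y: "y i \<bullet> y j = (if i = j then 1 else 0)" if "i \<in> J" "j \<in> J" for i j
  proof -
    \<comment> \<open>As \<open>v\<close> is a unit vector, the terms in \<open>w i * w j\<close>
      cancel and only \<open>x i \<bullet> x j\<close> remains.\<close>
    have "y i \<bullet> y j = 2 * w i * (2 * w j * (v \<bullet> v) - v \<bullet> x j) - (2 * w j * (x i \<bullet> v) - x i \<bullet> x j)"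
      using v(1) x y unfolding y_def
      by (simp add: minus_scalar_prod_distrib[of _ n] scalar_prod_minus_distrib[of _ n] algebra_simps)
    then show ?thesis using that by (simp add: v(2) vx xv orth_x algebra_simps)
  qed
  have Axv: "(A *\<^sub>v x j) \<bullet> v = e * w j" if "j \<in> J" for j
    using transpose_vec_mult_scalar[OF A(1) v(1) x, of j] A(2) v x that by (simp add: xv)
  have Axx: "(A *\<^sub>v x j) \<bullet> x j = 0" for j
  proof -
    have "A $$ (i, m) * x j $ m * x j $ i = 0" if "i < n" "m < n" for i m
      using proper[OF that] that by (simp add: x_def)
    moreover have "(A *\<^sub>v x j) \<bullet> x j = (\<Sum>i<n. \<Sum>m<n. A $$ (i, m) * x j $ m * x j $ i)"
      using A(1) x[of j] by (auto simp: scalar_prod_def atLeast0LessThan sum_distrib_right)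
    ultimately show ?thesis by (auto intro!: sum.neutral)
  qed
  have "(\<Sum>j\<in>J. w j * w j) = (\<Sum>j<k. w j * w j)"
    by (intro sum.mono_neutral_left) (auto simp: J_def)
  also have "\<dots> = (\<Sum>i<n. \<Sum>j<k. if c i = j then (v $ i)\<^sup>2 else 0)"
    unfolding w2 by (rule sum.swap)
  \<comment> \<open>Each index has exactly one colour below \<open>k\<close>, so the classes split
    the squared norm of \<open>v\<close>.\<close>
  also have "\<dots> = (\<Sum>i<n. (v $ i)\<^sup>2)" using colours by (intro sum.cong) auto
  also have "\<dots> = 1" using v by (simp add: scalar_prod_def power2_eq_square atLeast0LessThan)
  finally have w_sum: "(\<Sum>j\<in>J. w j * w j) = 1" .
  have "(A *\<^sub>v x j) \<bullet> y j = 2 * e * (w j * w j)" if "j \<in> J" for j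
    using v(1) x A(1) Axv[OF that] Axx[of j] unfolding y_def
    by (simp add: scalar_prod_minus_distrib[of _ n])
  then have "(\<Sum>j\<in>J. (A *\<^sub>v x j) \<bullet> y j) = 2 * e"
    by (simp add: w_sum flip: sum_distrib_left)
  then show ?thesis
    using ky_fan_maximum_principle[OF A J \<open>k > 0\<close> x y orth_x orth_y] by simp
qed

section \<open>Application to graphs\<close>

text \<open>The minimum is attained once some proper colouring exists. Without loops, an injective
  numbering of the finitely many vertices is one.\<close>

lemma chromatic_number_colouring:
  fixes G :: "('a, 'b) pre_digraph"
  assumes "finite (verts G)" and "\<And>v. v \<in> verts G \<Longrightarrow> \<not> v \<rightarrow>\<^bsub>G\<^esub> v"
  shows "\<exists>c. proper_colouring G (chromatic_number G) c"
proof -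
  obtain f where f: "inj_on f (verts G)" "f ` verts G = {0..<card (verts G)}"
    using ex_bij_betw_finite_nat[OF assms(1)] unfolding bij_betw_def by blast
  have "proper_colouring G (card (verts G)) f"
    unfolding proper_colouring_def using f assms(2) by (auto simp: inj_on_def)
  then have "\<exists>c. proper_colouring G (card (verts G)) c" by (rule exI[of _ f])
  then show ?thesis unfolding chromatic_number_def by (rule LeastI)
qed

theorem theorem9:
  fixes G :: "('a, 'b) pre_digraph" and vs :: "'a list"
  assumes "graph G"
    and "distinct vs" and "set vs = verts G"
    and "chromatic_number G \<ge> 2"
  shows "ky_fan_norm (chromatic_number G) (adjacency_matrix G vs)
           \<ge> 2 * largest_eigenvalue (adjacency_matrix G vs)"
proof -
  interpret graph G by fact
  let ?n = "length vs" and ?k = "chromatic_number G"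
  define A where "A = adjacency_matrix G vs"
  have A: "A \<in> carrier_mat ?n ?n" by (simp add: A_def adjacency_matrix_def)
  have symA: "transpose_mat A = A"
    by (rule eq_matI) (auto simp: A_def adjacency_matrix_def intro: arcs_ends_symmetric)
  obtain c where c: "proper_colouring G ?k c"
    using chromatic_number_colouring[OF finite_verts] adj_not_same by blast
  \<comment> \<open>A matrix of dimension 0 has no eigenvalues, so \<open>Max\<close> would be taken
    over the empty set. The empty graph is excluded because its chromatic number is 0.\<close>
  have "vs \<noteq> []"
  proof
    assume "vs = []"
    then have "proper_colouring G 0 c" using assms(3) by (simp add: proper_colouring_def)
    then have "\<exists>c. proper_colouring G 0 c" by (rule exI[of _ c])
    then have "?k \<le> 0" unfolding chromatic_number_def by (rule Least_le)
    then show False using assms(4) by simp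
  qed
  then have "spectrum A \<noteq> {}"
    using symmetric_real_eigenvalue_exists[OF A symA] by (auto simp: spectrum_def)
  then have "eigenvalue A (largest_eigenvalue A)"
    using Max_in[OF card_finite_spectrum(1)[OF A]] by (simp add: largest_eigenvalue_def spectrum_def)
  then show ?thesis unfolding A_def[symmetric]
  proof (rule two_eigenvalue_le_ky_fan_norm[OF A symA, where c = "\<lambda>i. c (vs ! i)"])
    fix i j assume "i < ?n" "j < ?n" "c (vs ! i) = c (vs ! j)"
    then have "\<not> vs ! i \<rightarrow>\<^bsub>G\<^esub> vs ! j"
      using c assms(3) nth_mem unfolding proper_colouring_def by blast
    then show "A $$ (i, j) = 0" using \<open>i < ?n\<close> \<open>j < ?n\<close> by (simp add: A_def adjacency_matrix_def)
  qed (use c assms in \<open>auto simp: proper_colouring_def\<close>)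
qed

end
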